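(* Let $m,n$ be positive integers, let $\mathcal A,\mathcal E\in\mathbb R^{m\times n\times m\times n}$ be fourth order partially symmetric tensors, set $\widetilde{\mathcal A}=\mathcal A+\mathcal E$, and let $\alpha,\beta>0$. Then $$\left|\lambda_{\max}^{M}(\widetilde{\mathcal A})-\lambda_{\max}^{M}(\mathcal A)\right|\le8\alpha^2\beta^2\rho_B(\mathcal B_{\mathcal E})=2\rho_Z(\mathcal B_{\mathcal E}).$$
   Context: Notation: $[m]=\{1,\dots,m\}$, $m+[n]=\{m+1,\dots,m+n\}$; $\mathbb R^{[4,N]}$ is the space of real fourth order tensors of size $N\times N\times N\times N$. A tensor $\mathcal A=(a_{ijkl})\in\mathbb R^{m\times n\times m\times n}$ is partially symmetric if $a_{ijkl}=a_{kjil}=a_{ilkj}=a_{klij}$ for all $i,k\in[m]$, $j,l\in[n]$. Put $\mathcal A\mathbf x\mathbf y\mathbf x\mathbf y=\sum_{i,k\in[m];\,j,l\in[n]}a_{ijkl}x_iy_jx_ky_l$ for $\mathbf x\in\mathbb R^m$, $\mathbf y\in\mathbb R^n$, and let the largest $M$-eigenvalue be $$\lambda_{\max}^{M}(\mathcal A):=\max_{\mathbf x^\top\mathbf x=1,\ \mathbf y^\top\mathbf y=1}\mathcal A\mathbf x\mathbf y\mathbf x\mathbf y.$$ For partially symmetric $\mathcal A$, the lifted tensor $\mathcal B_{\mathcal A}=(b_{t_1t_2t_3t_4})\in\mathbb R^{[4,m+n]}$ is $$b_{t_1t_2t_3t_4}=\begin{cases}a_{t_1,\,t_2-m,\,t_3,\,t_4-m},&t_1,t_3\in[m],\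 t_2,t_4\in m+[n],\\ a_{t_2,\,t_3-m,\,t_4,\,t_1-m},&t_1,t_3\in m+[n],\ t_2,t_4\in[m],\\0,&\text{otherwise.}\end{cases}$$ Put $\mathcal B_{\mathcal A}\mathbf w^4=\sum_{t_1,t_2,t_3,t_4\in[m+n]}b_{t_1t_2t_3t_4}w_{t_1}w_{t_2}w_{t_3}w_{t_4}$ for $\mathbf w\in\mathbb R^{m+n}$, let $\mathbf B_{\alpha,\beta}=\operatorname{diag}(2\beta^2\mathbf I_m,2\alpha^2\mathbf I_n)$, and define $$\rho_Z(\mathcal B_{\mathcal A}):=\max\{|\mathcal B_{\mathcal A}\mathbf z^4|:\mathbf z\in\mathbb R^{m+n},\ \mathbf z^\top\mathbf z=1\},\qquad\rho_B(\mathcal B_{\mathcal A}):=\max\{|\mathcal B_{\mathcal A}\mathbf w^4|:\mathbf w\in\mathbb R^{m+n},\ \mathbf w^\top\mathbf B_{\alpha,\beta}\mathbf w=1\}.$$ *)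

theory Defs
  imports "HOL-Analysis.Analysis"
begin

text \<open>
  The dimensions \<open>m\<close> and \<open>n\<close> are the cardinalities of the finite index types \<open>'m\<close> and \<open>'n\<close>.
  The index set \<open>[m + n]\<close> is the sum type \<open>'m + 'n\<close>: \<open>Inl i\<close> stands for an index \<open>i\<close> in \<open>[m]\<close>,
  and \<open>Inr j\<close> for the shifted index \<open>m + j\<close> in \<open>m + [n]\<close>.  The entry \<open>a\<^sub>i\<^sub>j\<^sub>k\<^sub>l\<close> of a tensor is
  \<open>A $ i $ j $ k $ l\<close>.
\<close>

type_synonym ('m, 'n) mn_tensor = "real ^ 'n ^ 'm ^ 'n ^ 'm"
type_synonym 's tensor4 = "real ^ 's ^ 's ^ 's ^ 's"

definition partially_symmetric :: "('m::finite, 'n::finite) mn_tensor \<Rightarrow> bool" where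
  "partially_symmetric A \<longleftrightarrow>
     (\<forall>i j k l. A $ i $ j $ k $ l = A $ k $ j $ i $ l \<and>
                A $ i $ j $ k $ l = A $ i $ l $ k $ j \<and>
                A $ i $ j $ k $ l = A $ k $ l $ i $ j)"

definition biquadratic_form ::
    "('m::finite, 'n::finite) mn_tensor \<Rightarrow> real ^ 'm \<Rightarrow> real ^ 'n \<Rightarrow> real" where
  "biquadratic_form A x y =
     (\<Sum>i\<in>UNIV. \<Sum>j\<in>UNIV. \<Sum>k\<in>UNIV. \<Sum>l\<in>UNIV.
        A $ i $ j $ k $ l * x $ i * y $ j * x $ k * y $ l)"

text \<open>
  \<open>GREATEST\<close> is the maximum in the strict sense; it is meaningful only when attained, which
  is shown below for each of the three quantities defined with it.
\<close>

definition lambda_max_M :: "('m::finite, 'n::finite) mn_tensor \<Rightarrow> real" where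
  "lambda_max_M A = (GREATEST r. \<exists>x y. x \<bullet> x = 1 \<and> y \<bullet> y = 1 \<and> r = biquadratic_form A x y)"

definition lifted_tensor ::
    "('m::finite, 'n::finite) mn_tensor \<Rightarrow> ('m + 'n) tensor4" where
  "lifted_tensor A = (\<chi> t1 t2 t3 t4.
     case (t1, t2, t3, t4) of
       (Inl i, Inr j, Inl k, Inr l) \<Rightarrow> A $ i $ j $ k $ l
     | (Inr l, Inl i, Inr j, Inl k) \<Rightarrow> A $ i $ j $ k $ l
     | _ \<Rightarrow> 0)"

definition quartic_form :: "'s::finite tensor4 \<Rightarrow> real ^ 's \<Rightarrow> real" where
  "quartic_form B w =
     (\<Sum>t1\<in>UNIV. \<Sum>t2\<in>UNIV. \<Sum>t3\<in>UNIV. \<Sum>t4\<in>UNIV.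
        B $ t1 $ t2 $ t3 $ t4 * w $ t1 * w $ t2 * w $ t3 * w $ t4)"

definition weight_matrix :: "real \<Rightarrow> real \<Rightarrow> real ^ ('m::finite + 'n::finite) ^ ('m + 'n)" where
  "weight_matrix \<alpha> \<beta> = (\<chi> s t.
     if s = t then (case s of Inl _ \<Rightarrow> 2 * \<beta>\<^sup>2 | Inr _ \<Rightarrow> 2 * \<alpha>\<^sup>2) else 0)"

definition rho_Z :: "'s::finite tensor4 \<Rightarrow> real" where
  "rho_Z B = (GREATEST r. \<exists>z. z \<bullet> z = 1 \<and> r = \<bar>quartic_form B z\<bar>)"

definition rho_B :: "real \<Rightarrow> real \<Rightarrow> ('m::finite + 'n::finite) tensor4 \<Rightarrow> real" where
  "rho_B \<alpha> \<beta> B =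
     (GREATEST r. \<exists>w. w \<bullet> (weight_matrix \<alpha> \<beta> *v w) = 1 \<and> r = \<bar>quartic_form B w\<bar>)"

lemma Greatest_compact_attained:
  fixes f :: "'a::topological_space \<Rightarrow> real"
  assumes "compact S" "S \<noteq> {}" "continuous_on S f"
  shows "\<exists>x\<in>S. (GREATEST r. \<exists>x\<in>S. r = f x) = f x \<and> (\<forall>y\<in>S. f y \<le> f x)"
proof -
  obtain x where x: "x \<in> S" "\<forall>y\<in>S. f y \<le> f x"
    using continuous_attains_sup[OF assms] by blast
  then have "(GREATEST r. \<exists>x\<in>S. r = f x) = f x"
    by (intro Greatest_equality) auto
  with x show ?thesis by blast
qed

lemma unit_sphere_inner: "{x::'a::real_inner. x \<bullet> x = 1} = sphere 0 1"
  by (auto simp: norm_eq_1)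

lemma lambda_max_M_attained:
  fixes A :: "('m::finite, 'n::finite) mn_tensor"
  shows "\<exists>x y. x \<bullet> x = 1 \<and> y \<bullet> y = 1 \<and> lambda_max_M A = biquadratic_form A x y \<and>
           (\<forall>x' y'. x' \<bullet> x' = 1 \<longrightarrow> y' \<bullet> y' = 1 \<longrightarrow>
              biquadratic_form A x' y' \<le> biquadratic_form A x y)"
proof -
  let ?S = "sphere (0::real^'m) 1 \<times> sphere (0::real^'n) 1"
  have "\<exists>p\<in>?S. (GREATEST r. \<exists>p\<in>?S. r = (\<lambda>(x, y). biquadratic_form A x y) p)
        = (\<lambda>(x, y). biquadratic_form A x y) p \<and>
        (\<forall>q\<in>?S. (\<lambda>(x, y). biquadratic_form A x y) q \<le> (\<lambda>(x, y). biquadratic_form A x y) p)"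
    by (rule Greatest_compact_attained)
      (auto simp: biquadratic_form_def split_def intro!: compact_Times continuous_intros)
  then show ?thesis
    unfolding lambda_max_M_def
    by (simp add: unit_sphere_inner[symmetric] del: mem_sphere sphere_eq_empty)
qed

lemma rho_Z_attained:
  fixes B :: "'s::finite tensor4"
  shows "\<exists>z. z \<bullet> z = 1 \<and> rho_Z B = \<bar>quartic_form B z\<bar> \<and>
           (\<forall>z'. z' \<bullet> z' = 1 \<longrightarrow> \<bar>quartic_form B z'\<bar> \<le> \<bar>quartic_form B z\<bar>)"
proof -
  let ?S = "{z::real^'s. z \<bullet> z = 1}"
  have "\<exists>z\<in>?S. (GREATEST r. \<exists>z\<in>?S. r = \<bar>quartic_form B z\<bar>) = \<bar>quartic_form B z\<bar> \<and>
        (\<forall>y\<in>?S. \<bar>quartic_form B y\<bar> \<le> \<bar>quartic_form B z\<bar>)"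
    unfolding unit_sphere_inner
    by (rule Greatest_compact_attained) (auto simp: quartic_form_def intro!: continuous_intros)
  then show ?thesis unfolding rho_Z_def by simp
qed

lemma weight_matrix_form:
  fixes w :: "real ^ ('m::finite + 'n::finite)"
  shows "w \<bullet> (weight_matrix \<alpha> \<beta> *v w) =
    (\<Sum>s\<in>UNIV. (case s of Inl _ \<Rightarrow> 2 * \<beta>\<^sup>2 | Inr _ \<Rightarrow> 2 * \<alpha>\<^sup>2) * (w $ s)\<^sup>2)"
  unfolding inner_vec_def matrix_vector_mult_def weight_matrix_def
  by (simp add: if_distrib[of "\<lambda>x. x * _"] if_distribR power2_eq_square cong: if_cong)
    (simp add: mult_ac)

lemma rho_B_attained:
  fixes B :: "('m::finite + 'n::finite) tensor4"
  assumes "\<alpha> > 0" "\<beta> > 0"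
  shows "\<exists>w. w \<bullet> (weight_matrix \<alpha> \<beta> *v w) = 1 \<and> rho_B \<alpha> \<beta> B = \<bar>quartic_form B w\<bar> \<and>
           (\<forall>w'. w' \<bullet> (weight_matrix \<alpha> \<beta> *v w') = 1 \<longrightarrow>
              \<bar>quartic_form B w'\<bar> \<le> \<bar>quartic_form B w\<bar>)"
proof -
  let ?S = "{w::real^('m + 'n). w \<bullet> (weight_matrix \<alpha> \<beta> *v w) = 1}"
  define c where "c = min (2 * \<beta>\<^sup>2) (2 * \<alpha>\<^sup>2)"
  have c: "c > 0" using assms by (simp add: c_def)
  have lower: "c * (norm w)\<^sup>2 \<le> w \<bullet> (weight_matrix \<alpha> \<beta> *v w)" for w :: "real^('m + 'n)"
  proof -
    have "c * (norm w)\<^sup>2 = (\<Sum>s\<in>UNIV. c * (w $ s)\<^sup>2)"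
      unfolding power2_norm_eq_inner by (simp add: inner_vec_def power2_eq_square sum_distrib_left)
    also have "\<dots> \<le> w \<bullet> (weight_matrix \<alpha> \<beta> *v w)"
      unfolding weight_matrix_form
      by (intro sum_mono mult_right_mono) (auto simp: c_def split: sum.split)
    finally show ?thesis .
  qed
  have "bounded ?S"
  proof (rule boundedI)
    fix w assume "w \<in> ?S"
    then have "(norm w)\<^sup>2 \<le> 1 / c" using lower[of w] c by (simp add: field_simps)
    then show "norm w \<le> sqrt (1 / c)" by (rule real_le_rsqrt)
  qed
  moreover have "closed ?S"
    unfolding weight_matrix_form by (intro closed_Collect_eq continuous_intros)
  ultimately have "compact ?S" by (simp add: compact_eq_bounded_closed)
  moreover have "?S \<noteq> {}"
  proof -
    define u :: "real^('m + 'n)" where "u = 1"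
    define q where "q = u \<bullet> (weight_matrix \<alpha> \<beta> *v u)"
    have "u \<noteq> 0" by (simp add: u_def)
    then have "q > 0" using lower[of u] c unfolding q_def
      by (smt (verit) mult_pos_pos zero_less_norm_iff zero_less_power)
    then have "(1 / sqrt q) *\<^sub>R u \<in> ?S"
      by (simp add: matrix_vector_mult_scaleR q_def[symmetric] flip: power2_eq_square)
    then show ?thesis by blast
  qed
  ultimately have "\<exists>w\<in>?S. (GREATEST r. \<exists>w\<in>?S. r = \<bar>quartic_form B w\<bar>) = \<bar>quartic_form B w\<bar> \<and>
        (\<forall>y\<in>?S. \<bar>quartic_form B y\<bar> \<le> \<bar>quartic_form B w\<bar>)"
    by (rule Greatest_compact_attained) (auto simp: quartic_form_def intro!: continuous_intros)
  then show ?thesis unfolding rho_B_def by simp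
qed

end

theory Submission
  imports Defs
begin

text \<open>
  Splitting \<open>w = (u, v)\<close> turns the quartic form of the lifted tensor into twice the biquadratic
  form of \<open>E\<close> at \<open>(u, v)\<close>.  If \<open>M\<close> is the maximum of the absolute value of the biquadratic form
  on the product of the unit spheres, homogeneity bounds it by \<open>M \<parallel>u\<parallel>\<^sup>2 \<parallel>v\<parallel>\<^sup>2\<close>, and AM-GM shows that on
  \<open>p \<parallel>u\<parallel>\<^sup>2 + q \<parallel>v\<parallel>\<^sup>2 = 1\<close> the product \<open>\<parallel>u\<parallel>\<^sup>2 \<parallel>v\<parallel>\<^sup>2\<close> is at most \<open>1 / (4 p q)\<close>, with equality at
  \<open>p \<parallel>u\<parallel>\<^sup>2 = q \<parallel>v\<parallel>\<^sup>2 = 1/2\<close>.  Thus the two spectral radii are \<open>M / (2 p q)\<close> for the corresponding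
  weights, and \<open>M\<close> bounds the perturbation of the largest M-eigenvalue.
\<close>

definition inl_part :: "real ^ ('m::finite + 'n::finite) \<Rightarrow> real ^ 'm" where
  "inl_part w = (\<chi> i. w $ Inl i)"

definition inr_part :: "real ^ ('m::finite + 'n::finite) \<Rightarrow> real ^ 'n" where
  "inr_part w = (\<chi> j. w $ Inr j)"

definition join_parts :: "real ^ 'm \<Rightarrow> real ^ 'n \<Rightarrow> real ^ ('m::finite + 'n::finite)" where
  "join_parts u v = (\<chi> s. case s of Inl i \<Rightarrow> u $ i | Inr j \<Rightarrow> v $ j)"

lemma inl_part_join_parts [simp]: "inl_part (join_parts u v) = u"
  by (simp add: inl_part_def join_parts_def vec_eq_iff)

lemma inr_part_join_parts [simp]: "inr_part (join_parts u v) = v"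
  by (simp add: inr_part_def join_parts_def vec_eq_iff)

lemma sum_UNIV_sum_type:
  fixes f :: "'a::finite + 'b::finite \<Rightarrow> 'c::comm_monoid_add"
  shows "(\<Sum>s\<in>UNIV. f s) = (\<Sum>i\<in>UNIV. f (Inl i)) + (\<Sum>j\<in>UNIV. f (Inr j))"
  by (simp add: UNIV_Plus_UNIV[symmetric] sum.Plus comp_def del: UNIV_Plus_UNIV)

text \<open>Only the two alternating index patterns of \<open>lifted_tensor E\<close> are nonzero,
  and each contributes one full copy of the biquadratic form.\<close>

lemma quartic_form_lifted_tensor:
  fixes E :: "('m::finite, 'n::finite) mn_tensor"
  shows "quartic_form (lifted_tensor E) w = 2 * biquadratic_form E (inl_part w) (inr_part w)"
proof -
  let ?f = "\<lambda>i j k l. E $ i $ j $ k $ l * w $ Inl i * w $ Inr j * w $ Inl k * w $ Inr l"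
  \<comment> \<open>The second pattern is cyclically shifted, so its sum has \<open>l\<close>
    outermost; three swaps carry \<open>l\<close> to the innermost place.\<close>
  have "(\<Sum>l\<in>UNIV. \<Sum>i\<in>UNIV. \<Sum>j\<in>UNIV. \<Sum>k\<in>UNIV. ?f i j k l)
      = (\<Sum>i\<in>UNIV. \<Sum>l\<in>UNIV. \<Sum>j\<in>UNIV. \<Sum>k\<in>UNIV. ?f i j k l)"
    by (rule sum.swap)
  also have "\<dots> = (\<Sum>i\<in>UNIV. \<Sum>j\<in>UNIV. \<Sum>l\<in>UNIV. \<Sum>k\<in>UNIV. ?f i j k l)"
    by (intro sum.cong refl sum.swap)
  also have "\<dots> = (\<Sum>i\<in>UNIV. \<Sum>j\<in>UNIV. \<Sum>k\<in>UNIV. \<Sum>l\<in>UNIV. ?f i j k l)"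
    by (intro sum.cong refl sum.swap)
  finally show ?thesis
    by (simp add: quartic_form_def lifted_tensor_def biquadratic_form_def inl_part_def inr_part_def
        sum_UNIV_sum_type mult_ac)
qed

lemma inner_parts: "w \<bullet> w = (norm (inl_part w))\<^sup>2 + (norm (inr_part w))\<^sup>2"
  by (simp add: power2_norm_eq_inner inner_vec_def inl_part_def inr_part_def sum_UNIV_sum_type)

lemma weight_matrix_form_parts:
  "w \<bullet> (weight_matrix \<alpha> \<beta> *v w)
    = 2 * \<beta>\<^sup>2 * (norm (inl_part w))\<^sup>2 + 2 * \<alpha>\<^sup>2 * (norm (inr_part w))\<^sup>2"
  unfolding weight_matrix_form power2_norm_eq_inner
  by (simp add: inner_vec_def inl_part_def inr_part_def sum_UNIV_sum_type
      sum_distrib_left power2_eq_square)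

lemma biquadratic_form_scaleR:
  "biquadratic_form A (a *\<^sub>R x) (b *\<^sub>R y) = a\<^sup>2 * b\<^sup>2 * biquadratic_form A x y"
  by (simp add: biquadratic_form_def sum_distrib_left power2_eq_square mult_ac)

lemma biquadratic_form_add:
  "biquadratic_form (A + E) x y = biquadratic_form A x y + biquadratic_form E x y"
  by (simp add: biquadratic_form_def sum.distrib distrib_right)

lemma biquadratic_form_abs_attained:
  fixes A :: "('m::finite, 'n::finite) mn_tensor"
  obtains x y where "x \<bullet> x = 1" "y \<bullet> y = 1"
    "\<And>x' y'. x' \<bullet> x' = 1 \<Longrightarrow> y' \<bullet> y' = 1 \<Longrightarrow>
      \<bar>biquadratic_form A x' y'\<bar> \<le> \<bar>biquadratic_form A x y\<bar>"
proof -
  let ?S = "sphere (0::real^'m) 1 \<times> sphere (0::real^'n) 1"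
  have "\<exists>p\<in>?S. \<forall>q\<in>?S. \<bar>biquadratic_form A (fst q) (snd q)\<bar> \<le> \<bar>biquadratic_form A (fst p) (snd p)\<bar>"
    by (rule continuous_attains_sup)
      (auto simp: biquadratic_form_def intro!: compact_Times continuous_intros)
  then show thesis
    using that by (auto simp: norm_eq_1)
qed

lemma abs_biquadratic_form_le:
  assumes M: "\<And>x y. x \<bullet> x = 1 \<Longrightarrow> y \<bullet> y = 1 \<Longrightarrow> \<bar>biquadratic_form A x y\<bar> \<le> M"
  shows "\<bar>biquadratic_form A u v\<bar> \<le> M * ((norm u)\<^sup>2 * (norm v)\<^sup>2)"
proof (cases "u = 0 \<or> v = 0")
  case True
  then show ?thesis by (auto simp: biquadratic_form_def)
next
  \<comment> \<open>For nonzero vectors \<open>sgn\<close> is normalisation to length 1; since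
    \<open>sgn 0 = 0\<close>, the zero case had to be split off.\<close>
  case False
  have "\<bar>biquadratic_form A (sgn u) (sgn v)\<bar> \<le> M"
    using False by (intro M) (simp_all add: norm_sgn flip: norm_eq_1)
  moreover have "biquadratic_form A u v
      = (norm u)\<^sup>2 * (norm v)\<^sup>2 * biquadratic_form A (sgn u) (sgn v)"
    using False by (simp add: biquadratic_form_scaleR[symmetric] sgn_div_norm)
  ultimately show ?thesis
    by (simp add: abs_mult mult.commute mult_right_mono)
qed

text \<open>General weights \<open>p\<close>, \<open>q\<close> treat both radii at once:
  \<open>p = 2 * \<beta>\<^sup>2\<close>, \<open>q = 2 * \<alpha>\<^sup>2\<close> gives
  \<open>rho_B\<close>, and \<open>p = q = 1\<close> gives \<open>rho_Z\<close>.\<close>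

lemma Greatest_abs_quartic_form_lifted_tensor:
  fixes E :: "('m::finite, 'n::finite) mn_tensor"
  assumes pq: "p > 0" "q > 0"
    and x0: "x0 \<bullet> x0 = 1" and y0: "y0 \<bullet> y0 = 1"
    and max: "\<And>x y. x \<bullet> x = 1 \<Longrightarrow> y \<bullet> y = 1 \<Longrightarrow>
      \<bar>biquadratic_form E x y\<bar> \<le> \<bar>biquadratic_form E x0 y0\<bar>"
  shows "(GREATEST r. \<exists>w. p * (norm (inl_part w))\<^sup>2 + q * (norm (inr_part w))\<^sup>2 = 1
            \<and> r = \<bar>quartic_form (lifted_tensor E) w\<bar>)
         = \<bar>biquadratic_form E x0 y0\<bar> / (2 * p * q)"
    (is "_ = ?M / _")
proof (rule Greatest_equality)
  \<comment> \<open>Scalings for the equality case of AM-GM: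
    \<open>p * a\<^sup>2 = q * b\<^sup>2 = 1/2\<close>.\<close>
  define a b where "a = 1 / sqrt (2 * p)" and "b = 1 / sqrt (2 * q)"
  have ab: "a\<^sup>2 = 1 / (2 * p)" "b\<^sup>2 = 1 / (2 * q)"
    using pq by (simp_all add: a_def b_def power_divide)
  have "norm x0 = 1" "norm y0 = 1"
    using x0 y0 by (simp_all add: norm_eq_1)
  then show "\<exists>w. p * (norm (inl_part w))\<^sup>2 + q * (norm (inr_part w))\<^sup>2 = 1
      \<and> ?M / (2 * p * q) = \<bar>quartic_form (lifted_tensor E) w\<bar>"
    using pq
    by (intro exI[of _ "join_parts (a *\<^sub>R x0) (b *\<^sub>R y0)"])
      (simp add: quartic_form_lifted_tensor biquadratic_form_scaleR power_mult_distrib ab abs_mult)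
next
  fix r
  assume "\<exists>w. p * (norm (inl_part w))\<^sup>2 + q * (norm (inr_part w))\<^sup>2 = 1
    \<and> r = \<bar>quartic_form (lifted_tensor E) w\<bar>"
  then obtain w where w: "p * (norm (inl_part w))\<^sup>2 + q * (norm (inr_part w))\<^sup>2 = 1"
    and r: "r = \<bar>quartic_form (lifted_tensor E) w\<bar>"
    by blast
  define s t where "s = (norm (inl_part w))\<^sup>2" and "t = (norm (inr_part w))\<^sup>2"
  \<comment> \<open>AM-GM for \<open>p * s\<close> and \<open>q * t\<close>, whose sum is 1 by the
    constraint on \<open>w\<close>.\<close>
  have "4 * ((p * s) * (q * t)) \<le> (p * s + q * t)\<^sup>2"
    using sum_squares_bound[of "p * s" "q * t"] by (simp add: power2_sum mult_ac)
  then have "s * t \<le> 1 / (4 * p * q)"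
    using w pq by (simp add: s_def t_def field_simps)
  then have "?M * (s * t) \<le> ?M * (1 / (4 * p * q))"
    by (intro mult_left_mono) auto
  moreover have "r \<le> 2 * (?M * (s * t))"
    using abs_biquadratic_form_le[OF max, of "inl_part w" "inr_part w"]
    by (simp add: r quartic_form_lifted_tensor abs_mult s_def t_def)
  ultimately show "r \<le> ?M / (2 * p * q)"
    by simp
qed

text \<open>Each maximiser is a competitor in the other problem: one for \<open>A\<close> gives the
  lower bound on \<open>lambda_max_M (A + E)\<close>, one for \<open>A + E\<close> the upper bound,
  and each costs one value of the form of \<open>E\<close>, at most \<open>M\<close> in absolute
  value.\<close>

lemma lambda_max_M_diff_le:
  assumes E: "\<And>x y. x \<bullet> x = 1 \<Longrightarrow> y \<bullet> y = 1 \<Longrightarrow> \<bar>biquadratic_form E x y\<bar> \<le> M"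
  shows "\<bar>lambda_max_M (A + E) - lambda_max_M A\<bar> \<le> M"
proof -
  obtain x y where xy: "x \<bullet> x = 1" "y \<bullet> y = 1" "lambda_max_M A = biquadratic_form A x y"
    and A: "\<And>x' y'. x' \<bullet> x' = 1 \<Longrightarrow> y' \<bullet> y' = 1 \<Longrightarrow> biquadratic_form A x' y' \<le> lambda_max_M A"
    using lambda_max_M_attained[of A] by metis
  obtain x' y' where xy': "x' \<bullet> x' = 1" "y' \<bullet> y' = 1"
      "lambda_max_M (A + E) = biquadratic_form (A + E) x' y'"
    and AE: "\<And>x y. x \<bullet> x = 1 \<Longrightarrow> y \<bullet> y = 1 \<Longrightarrow> biquadratic_form (A + E) x y \<le> lambda_max_M (A + E)"
    using lambda_max_M_attained[of "A + E"] by metis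
  show ?thesis
    using A[OF xy'(1,2)] AE[OF xy(1,2)] E[OF xy(1,2)] E[OF xy'(1,2)] xy(3) xy'(3)
    by (simp add: biquadratic_form_add)
qed

theorem corollary3p2:
  fixes A E :: "('m::finite, 'n::finite) mn_tensor" and \<alpha> \<beta> :: real
  assumes "partially_symmetric A" and "partially_symmetric E"
    and "\<alpha> > 0" and "\<beta> > 0"
  shows "\<bar>lambda_max_M (A + E) - lambda_max_M A\<bar> \<le> 8 * \<alpha>\<^sup>2 * \<beta>\<^sup>2 * rho_B \<alpha> \<beta> (lifted_tensor E)
    \<and> 8 * \<alpha>\<^sup>2 * \<beta>\<^sup>2 * rho_B \<alpha> \<beta> (lifted_tensor E) = 2 * rho_Z (lifted_tensor E)"
proof -
  obtain x0 y0 where 0: "x0 \<bullet> x0 = 1" "y0 \<bullet> y0 = 1"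
    "\<And>x y. x \<bullet> x = 1 \<Longrightarrow> y \<bullet> y = 1 \<Longrightarrow>
      \<bar>biquadratic_form E x y\<bar> \<le> \<bar>biquadratic_form E x0 y0\<bar>"
    using biquadratic_form_abs_attained[of E] by blast
  let ?M = "\<bar>biquadratic_form E x0 y0\<bar>"
  have "rho_B \<alpha> \<beta> (lifted_tensor E) = ?M / (2 * (2 * \<beta>\<^sup>2) * (2 * \<alpha>\<^sup>2))"
    unfolding rho_B_def weight_matrix_form_parts
    using assms(3,4) by (intro Greatest_abs_quartic_form_lifted_tensor 0) auto
  then have B: "8 * \<alpha>\<^sup>2 * \<beta>\<^sup>2 * rho_B \<alpha> \<beta> (lifted_tensor E) = ?M"
    using assms(3,4) by simp
  \<comment> \<open>With unit weights the denominator \<open>2 * p * q\<close> is 2, which the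
    factor 2 cancels.\<close>
  have Z: "2 * rho_Z (lifted_tensor E) = ?M"
    using Greatest_abs_quartic_form_lifted_tensor[of 1 1, OF _ _ 0]
    by (simp add: rho_Z_def inner_parts)
  show ?thesis
    using lambda_max_M_diff_le[OF 0(3)] B Z by simp
qed

end
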